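(* Let $G$ be a $C_{4k}$-free bipartite graph. Then $\operatorname{Supp}(C_S(G))=\operatorname{Supp}(G)$, $\operatorname{Core}(C_S(G))=\operatorname{Core}(G)$, and $\operatorname{Npart}(C_N(G))=\operatorname{Npart}(G)$. Furthermore, $\operatorname{Npart}(C_S(G))=\operatorname{Supp}(C_N(G))=\operatorname{Core}(C_N(G))=\emptyset$.
   Context: All graphs are finite, simple and undirected. A graph is a $C_{4k}$-free bipartite graph if it is bipartite and contains no cycle whose length is a multiple of $4$. For a graph $G$, $\operatorname{Null}(G)$ is the null space of its adjacency matrix, viewed as a subspace of $\mathbb{R}^{V(G)}$; $\operatorname{Supp}(G)$ is the set of vertices $v$ with $\vec{x}_v\neq0$ for some $\vec{x}\in\operatorname{Null}(G)$; $\operatorname{Core}(G)$ is the set of vertices adjacent to some vertex of $\operatorname{Supp}(G)$; $\operatorname{Npart}(G)=V(G)\setminus(\operatorname{Supp}(G)\cup\operatorname{Core}(G))$. $C_S(G)$ is the subgraph of $G$ induced by $\operatorname{Supp}(G)\cup\operatorname{Core}(G)$, and $C_N(G)$ is the subgraph of $G$ induced by $\operatorname{Npart}(G)$. *)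

theory Defs
  imports Complex_Main "Graph_Theory.Digraph_Component"
begin

text \<open>
  Finite simple undirected graphs are modelled by the locale \<^locale>\<open>graph\<close>: finite, loop-free
  digraphs without parallel arcs in which every arc has a reverse arc. Adjacency of \<open>u\<close> and \<open>v\<close> is
  \<open>u \<rightarrow>\<^bsub>G\<^esub> v\<close>, and \<open>G \<restriction> S\<close> is the induced subgraph.
\<close>

definition bipartite :: "('a, 'b) pre_digraph \<Rightarrow> bool" where
  "bipartite G \<longleftrightarrow>
    (\<exists>X Y. X \<union> Y = verts G \<and> X \<inter> Y = {} \<and>
      (\<forall>u v. u \<rightarrow>\<^bsub>G\<^esub> v \<longrightarrow> u \<in> X \<and> v \<in> Y \<or> u \<in> Y \<and> v \<in> X))"

text \<open>
  In a symmetric digraph \<open>pre_digraph.cycle\<close> also admits the closed walk \<open>u, v, u\<close>, which is not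
  a cycle of the undirected graph. It has length 2, so it does not matter below; the cycles of
  length at least 3 are the undirected ones. The empty walk is not a \<open>pre_digraph.cycle\<close>.
\<close>
definition C4k_free_bipartite :: "('a, 'b) pre_digraph \<Rightarrow> bool" where
  "C4k_free_bipartite G \<longleftrightarrow>
    bipartite G \<and> \<not> (\<exists>p. pre_digraph.cycle G p \<and> 4 dvd length p)"

definition adj_matrix :: "('a, 'b) pre_digraph \<Rightarrow> 'a \<Rightarrow> 'a \<Rightarrow> real" where
  "adj_matrix G u v = (if u \<rightarrow>\<^bsub>G\<^esub> v then 1 else 0)"

text \<open>
  Vectors indexed by \<open>verts G\<close> are represented by functions on the whole vertex type that vanish
  outside \<open>verts G\<close>.
\<close>
definition Null :: "('a, 'b) pre_digraph \<Rightarrow> ('a \<Rightarrow> real) set" where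
  "Null G = {x. (\<forall>v. v \<notin> verts G \<longrightarrow> x v = 0) \<and>
    (\<forall>u \<in> verts G. (\<Sum>v \<in> verts G. adj_matrix G u v * x v) = 0)}"

definition Supp :: "('a, 'b) pre_digraph \<Rightarrow> 'a set" where
  "Supp G = {v \<in> verts G. \<exists>x \<in> Null G. x v \<noteq> 0}"

definition Core :: "('a, 'b) pre_digraph \<Rightarrow> 'a set" where
  "Core G = {v \<in> verts G. \<exists>u \<in> Supp G. v \<rightarrow>\<^bsub>G\<^esub> u}"

definition Npart :: "('a, 'b) pre_digraph \<Rightarrow> 'a set" where
  "Npart G = verts G - (Supp G \<union> Core G)"

definition C_S :: "('a, 'b) pre_digraph \<Rightarrow> ('a, 'b) pre_digraph" where
  "C_S G = G \<restriction> (Supp G \<union> Core G)"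

definition C_N :: "('a, 'b) pre_digraph \<Rightarrow> ('a, 'b) pre_digraph" where
  "C_N G = G \<restriction> Npart G"

end

theory Submission
  imports Defs
begin

text \<open>
  Colour a vertex by the pair (side of the bipartition, sign of a vector entry). If \<open>x\<close> and
  \<open>y\<close> are null vectors with \<open>x\<close> read on one side and \<open>y\<close> on the other, then a vertex of the support
  with a neighbour in the support has such neighbours of both signs, so one can walk forever through
  the colours \<open>X+, Y+, X-, Y-, X+, \<dots>\<close>. The first repeated vertex closes a cycle of length divisible
  by 4. Hence in a \<open>C\<^sub>4\<^sub>k\<close>-free bipartite graph the supports of \<open>x\<close> and \<open>y\<close> are never joined by an
  edge. Since \<open>x\<close> is only required to be null at the vertices of the support of \<open>y\<close>, this shows that
  \<open>Supp\<close> and \<open>Core\<close> are disjoint, that null vectors of \<open>C_S\<close> vanish on \<open>Core\<close>, and likewise that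
  \<open>b\<close> vanishes on \<open>Core\<close> whenever \<open>A b = e\<^sub>v\<close> for the adjacency matrix \<open>A\<close> and \<open>v \<notin> Supp\<close>.
  Such a \<open>b\<close> exists by the Fredholm alternative, and pairing it with a null vector \<open>z\<close> of \<open>C_N\<close>
  gives \<open>z\<^sub>v = 0\<close>.
\<close>

section \<open>Cycles from vertex sequences and cyclic colourings\<close>

lemma (in wf_digraph) cycle_of_vertex_sequence:
  assumes arc: "\<And>i. f i \<rightarrow>\<^bsub>G\<^esub> f (Suc i)" and "i < n" "f i = f n" and inj: "inj_on f {i..<n}"
  shows "\<exists>p. cycle p \<and> length p = n - i"
proof -
  have "\<exists>e. e \<in> arcs G \<and> tail G e = f j \<and> head G e = f (Suc j)" for j
    using arc[of j] by (auto simp: arcs_ends_conv)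
  then obtain a where a: "\<And>j. a j \<in> arcs G" "\<And>j. tail G (a j) = f j"
      "\<And>j. head G (a j) = f (Suc j)"
    by metis
  have walk: "awalk (f i) (map a [i..<i + m]) (f (i + m))" for m
  proof (induction m)
    case 0
    show ?case using a(1)[of i] a(2)[of i] by (auto simp: awalk_Nil_iff dest: tail_in_verts)
  next
    case (Suc m)
    have "awalk (f (i + m)) [a (i + m)] (f (Suc (i + m)))"
      using a arc_implies_awalk by metis
    with Suc show ?case by (auto intro: awalk_appendI)
  qed
  define p where "p = map a [i..<n]"
  have "awalk (f i) p (f i)"
    using walk[of "n - i"] \<open>i < n\<close> \<open>f i = f n\<close> by (simp add: p_def)
  moreover from this have "awalk_verts (f i) p = tail G (hd p) # map (head G) p"
    using \<open>i < n\<close> awalk_verts_conv'[of "f i" p "f i"] by (auto simp: awalk_def p_def)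
  then have "tl (awalk_verts (f i) p) = map (\<lambda>j. f (Suc j)) [i..<n]"
    by (simp add: p_def a)
  \<comment> \<open>\<open>cycle\<close> asks for distinct vertices after the first one, that is at
    the indices \<open>Suc i\<close> to \<open>n\<close>. As \<open>f n = f i\<close>, renaming
    \<open>n\<close> to \<open>i\<close> reduces this to injectivity on
    \<open>{i..<n}\<close>.\<close>
  moreover have "inj_on f {Suc i..n}"
  proof (rule inj_onI)
    fix j k assume *: "j \<in> {Suc i..n}" "k \<in> {Suc i..n}" "f j = f k"
    define r where "r j = (if j = n then i else j)" for j
    have "f (r j) = f (r k)" "r j \<in> {i..<n}" "r k \<in> {i..<n}"
      using * \<open>i < n\<close> \<open>f i = f n\<close> by (auto simp: r_def)
    with inj have "r j = r k" by (auto dest: inj_onD)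
    with * show "j = k" by (auto simp: r_def split: if_splits)
  qed
  then have "inj_on (\<lambda>j. f (Suc j)) {i..<n}"
    using inj_on_eq_iff[of f "{Suc i..n}"] by (auto intro!: inj_onI)
  then have "distinct (map (\<lambda>j. f (Suc j)) [i..<n])"
    by (simp add: distinct_map)
  ultimately have "cycle p \<and> length p = n - i"
    using \<open>i < n\<close> by (auto simp: cycle_def p_def)
  then show ?thesis by blast
qed

text \<open>Iterating a choice of successors from \<open>v0\<close> must revisit a vertex of the
  finite graph. The first repetition closes a cycle; every arc advances the colour by one modulo
  \<open>k\<close>, so returning to the initial colour forces \<open>k\<close> to divide the
  length.\<close>

lemma (in fin_digraph) cycle_of_cyclic_colouring:
  fixes t :: "'a \<Rightarrow> nat"
  assumes "v0 \<in> W"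
    and step: "\<And>v. v \<in> W \<Longrightarrow> \<exists>w \<in> W. v \<rightarrow>\<^bsub>G\<^esub> w \<and> t w mod k = Suc (t v) mod k"
  shows "\<exists>p. cycle p \<and> k dvd length p"
proof -
  obtain s where s: "\<And>v. v \<in> W \<Longrightarrow> s v \<in> W \<and> v \<rightarrow>\<^bsub>G\<^esub> s v \<and> t (s v) mod k = Suc (t v) mod k"
    using step by metis
  define f where "f n = (s ^^ n) v0" for n
  have fW: "f n \<in> W" for n
    by (induction n) (auto simp: f_def \<open>v0 \<in> W\<close> s)
  have arc: "f n \<rightarrow>\<^bsub>G\<^esub> f (Suc n)" and t_Suc: "t (f (Suc n)) mod k = Suc (t (f n)) mod k" for n
    using s[OF fW[of n]] by (auto simp: f_def)
  have colour: "t (f (i + m)) mod k = (t (f i) + m) mod k" for i m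
  proof (induction m)
    case (Suc m)
    then show ?case using t_Suc[of "i + m"] by (metis add_Suc_right mod_Suc_eq)
  qed simp
  have "range f \<subseteq> verts G"
    using adj_in_verts(1)[OF arc] by blast
  then have "\<not> inj f"
    using finite_verts finite_subset range_inj_infinite by blast
  then have "\<exists>n. \<exists>i<n. f i = f n"
    unfolding inj_def by (metis linorder_neqE_nat)
  then obtain n where n: "\<exists>i<n. f i = f n" and least: "\<And>m. m < n \<Longrightarrow> \<not> (\<exists>i<m. f i = f m)"
    using exists_least_iff[of "\<lambda>n. \<exists>i<n. f i = f n"] by blast
  from n obtain i where i: "i < n" "f i = f n" by blast
  have "inj_on f {i..<n}"
    by (rule inj_onI) (metis atLeastLessThan_iff least linorder_neqE_nat)
  from cycle_of_vertex_sequence[OF arc i this]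
  obtain p where p: "cycle p" "length p = n - i" by blast
  have "(t (f i) + (n - i)) mod k = t (f i) mod k"
    using colour[of i "n - i"] i by simp
  then have "k dvd n - i"
    by (metis add_diff_cancel_left' le_add1 mod_eq_dvd_iff_nat)
  with p show ?thesis by auto
qed

section \<open>Linear algebra: signs in zero sums and the Fredholm alternative\<close>

lemma sum_zero_imp_pos_neg:
  fixes f :: "'a \<Rightarrow> real"
  assumes "finite A" "sum f A = 0" "a \<in> A" "f a \<noteq> 0"
  shows "\<exists>b \<in> A. f b > 0" "\<exists>b \<in> A. f b < 0"
proof -
  show "\<exists>b \<in> A. f b > 0"
  proof (rule ccontr)
    assume "\<not> ?thesis"
    then have "\<forall>b \<in> A. f b \<le> 0" by force
    with assms show False using sum_nonneg_eq_0_iff[of A "\<lambda>a. - f a"] by (auto simp: sum_negf)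
  qed
  show "\<exists>b \<in> A. f b < 0"
  proof (rule ccontr)
    assume "\<not> ?thesis"
    then have "\<forall>b \<in> A. f b \<ge> 0" by force
    with assms show False using sum_nonneg_eq_0_iff[of A f] by auto
  qed
qed

text \<open>Induction on the number of functionals: a multiple of the new one is subtracted from
  \<open>g\<close> so that the difference vanishes on the common kernel of the others. For the rows
  of a matrix this is the Fredholm alternative.\<close>

lemma vanishing_functional_is_combination:
  fixes a :: "'i \<Rightarrow> 'v \<Rightarrow> real"
  assumes "finite I" "finite V"
    and "\<And>x. \<forall>i \<in> I. (\<Sum>v \<in> V. a i v * x v) = 0 \<Longrightarrow> (\<Sum>v \<in> V. g v * x v) = 0"
  shows "\<exists>c. \<forall>v \<in> V. g v = (\<Sum>i \<in> I. c i * a i v)"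
  using assms(1,3)
proof (induction I arbitrary: g rule: finite_induct)
  case empty
  have "g w = 0" if "w \<in> V" for w
    using empty[of "\<lambda>v. if v = w then 1 else 0"] that \<open>finite V\<close>
    by (simp add: if_distrib[of "(*) _"] cong: if_cong)
  then show ?case by simp
next
  case (insert j I)
  let ?dot = "\<lambda>h x. \<Sum>v \<in> V. h v * x v :: real"
  have extend: "\<exists>c. \<forall>v \<in> V. g v = (\<Sum>i \<in> insert j I. c i * a i v)"
    if "\<forall>v \<in> V. g v - r * a j v = (\<Sum>i \<in> I. c i * a i v)" for r c
  proof (intro exI ballI)
    fix v assume "v \<in> V"
    have "(\<Sum>i \<in> I. (c(j := r)) i * a i v) = (\<Sum>i \<in> I. c i * a i v)"
      using insert.hyps by (intro sum.cong) auto
    then show "g v = (\<Sum>i \<in> insert j I. (c(j := r)) i * a i v)"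
      using that \<open>v \<in> V\<close> insert.hyps by (simp add: algebra_simps)
  qed
  show ?case
  proof (cases "\<exists>e. (\<forall>i \<in> I. ?dot (a i) e = 0) \<and> ?dot (a j) e \<noteq> 0")
    case False
    then have "\<exists>c. \<forall>v \<in> V. g v = (\<Sum>i \<in> I. c i * a i v)"
      by (intro insert.IH insert.prems) auto
    then show ?thesis using extend[of 0] by auto
  next
    case True
    then obtain e where e: "\<forall>i \<in> I. ?dot (a i) e = 0" "?dot (a j) e \<noteq> 0" by blast
    \<comment> \<open>This \<open>r\<close> makes \<open>g - r * a j\<close> vanish at
      \<open>e\<close>. Dually, \<open>q\<close> below shifts \<open>x\<close> along
      \<open>e\<close> into the kernel of \<open>a j\<close>, where the hypothesis on
      \<open>g\<close> applies.\<close>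
    define r where "r = ?dot g e / ?dot (a j) e"
    have "\<exists>c. \<forall>v \<in> V. g v - r * a j v = (\<Sum>i \<in> I. c i * a i v)"
    proof (rule insert.IH)
      fix x assume x: "\<forall>i \<in> I. ?dot (a i) x = 0"
      define q where "q = ?dot (a j) x / ?dot (a j) e"
      have lin: "?dot h (\<lambda>v. x v - q * e v) = ?dot h x - q * ?dot h e" for h
        by (simp add: algebra_simps sum_subtractf sum_distrib_left)
      have "?dot g (\<lambda>v. x v - q * e v) = 0"
        by (rule insert.prems, unfold lin) (use x e in \<open>auto simp: q_def\<close>)
      then have "?dot g x = q * ?dot g e" by (simp add: lin)
      also have "\<dots> = r * ?dot (a j) x" by (simp add: q_def r_def)
      finally show "(\<Sum>v \<in> V. (g v - r * a j v) * x v) = 0"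
        by (simp add: algebra_simps sum_subtractf sum_distrib_left)
    qed
    then show ?thesis using extend by blast
  qed
qed

section \<open>Null equations in induced subgraphs\<close>

lemma dominates_induce_subgraph_iff:
  "u \<rightarrow>\<^bsub>G \<restriction> T\<^esub> v \<longleftrightarrow> u \<in> T \<and> v \<in> T \<and> u \<rightarrow>\<^bsub>G\<^esub> v"
  by (auto simp: arcs_ends_conv)

lemma sum_adj_matrix_induce_subgraph:
  assumes "finite (verts G)" "T \<subseteq> verts G" "u \<in> T" "\<And>v. v \<notin> T \<Longrightarrow> x v = 0"
  shows "(\<Sum>v \<in> verts (G \<restriction> T). adj_matrix (G \<restriction> T) u v * x v) =
    (\<Sum>v \<in> verts G. adj_matrix G u v * x v)"
  unfolding induce_subgraph_verts
  by (rule sum.mono_neutral_cong_left)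
    (use assms in \<open>auto simp: adj_matrix_def dominates_induce_subgraph_iff\<close>)

section \<open>Adjacent supports force a cycle of length divisible by 4\<close>

locale C4k_free_graph = graph G for G :: "('a, 'b) pre_digraph" (structure) +
  assumes C4k_free: "C4k_free_bipartite G"
begin

abbreviation adj_sum :: "('a \<Rightarrow> real) \<Rightarrow> 'a \<Rightarrow> real" where
  "adj_sum x u \<equiv> \<Sum>v \<in> verts G. adj_matrix G u v * x v"

lemma adj_matrix_commute: "adj_matrix G u v = adj_matrix G v u"
  using graph_symmetric by (auto simp: adj_matrix_def)

lemma adj_sum_eq_0:
  assumes "\<And>v. u \<rightarrow>\<^bsub>G\<^esub> v \<Longrightarrow> x v = 0"
  shows "adj_sum x u = 0"
  using assms by (auto simp: adj_matrix_def intro!: sum.neutral)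

lemma Null_adj_sum:
  assumes "x \<in> Null G"
  shows "adj_sum x u = 0"
  using assms adj_in_verts by (cases "u \<in> verts G") (auto simp: Null_def intro: adj_sum_eq_0)

lemma supports_not_adjacent_bipartition:
  assumes XY: "X \<inter> Y = {}" "\<And>u v. u \<rightarrow>\<^bsub>G\<^esub> v \<Longrightarrow> u \<in> X \<and> v \<in> Y \<or> u \<in> Y \<and> v \<in> X"
    and y0: "\<And>u. x u \<noteq> 0 \<Longrightarrow> adj_sum y u = 0"
    and x0: "\<And>v. y v \<noteq> 0 \<Longrightarrow> adj_sum x v = 0"
    and "u \<rightarrow>\<^bsub>G\<^esub> v" "u \<in> X" "x u \<noteq> 0" "y v \<noteq> 0"
  shows False
proof -
  \<comment> \<open>Edges cross between the sides, so the sum of \<open>z\<close> at a vertex of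
    \<open>X\<close> sees only \<open>y\<close>, and on the other side only \<open>x\<close>. Hence
    \<open>z\<close> is null wherever it is nonzero.\<close>
  define z where "z w = (if w \<in> X then x w else y w)" for w
  \<comment> \<open>The nonzero neighbour gives the zero sum at \<open>w\<close> a nonzero term,
    hence terms of both signs.\<close>
  define W where "W = {w. z w \<noteq> 0 \<and> (\<exists>w'. w \<rightarrow>\<^bsub>G\<^esub> w' \<and> z w' \<noteq> 0)}"
  define t :: "'a \<Rightarrow> nat" where
    "t w = (if w \<in> X then if z w > 0 then 0 else 2 else if z w > 0 then 1 else 3)" for w
  have side: "a \<in> X \<longleftrightarrow> b \<notin> X" if "a \<rightarrow>\<^bsub>G\<^esub> b" for a b
    using XY that by blast
  have null: "adj_sum z a = 0" if "z a \<noteq> 0" for a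
  proof -
    have "adj_sum z a = adj_sum (if a \<in> X then y else x) a"
      by (rule sum.cong) (auto simp: adj_matrix_def z_def side)
    with that show ?thesis using x0 y0 by (auto simp: z_def split: if_splits)
  qed
  have pos_neg: "(\<exists>b. a \<rightarrow>\<^bsub>G\<^esub> b \<and> z b > 0) \<and> (\<exists>b. a \<rightarrow>\<^bsub>G\<^esub> b \<and> z b < 0)" if "a \<in> W" for a
  proof -
    from that obtain b where "z a \<noteq> 0" "a \<rightarrow>\<^bsub>G\<^esub> b" "z b \<noteq> 0" by (auto simp: W_def)
    with null[of a] show ?thesis
      using sum_zero_imp_pos_neg[of "verts G" "\<lambda>b. adj_matrix G a b * z b" b]
        adj_in_verts[of a b]
      by (fastforce simp: adj_matrix_def split: if_splits)
  qed
  have "v \<notin> X" using side[OF \<open>u \<rightarrow>\<^bsub>G\<^esub> v\<close>] \<open>u \<in> X\<close> by blast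
  then have "u \<in> W"
    using assms(5-8) by (auto simp: W_def z_def)
  moreover have "\<exists>b \<in> W. a \<rightarrow>\<^bsub>G\<^esub> b \<and> t b mod 4 = Suc (t a) mod 4" if "a \<in> W" for a
  proof -
    \<comment> \<open>In the cyclic order \<open>X+\<close>, \<open>Y+\<close>, \<open>X-\<close>,
      \<open>Y-\<close> the next sign is positive exactly after \<open>X+\<close> and
      \<open>Y-\<close>.\<close>
    have "\<exists>b. a \<rightarrow>\<^bsub>G\<^esub> b \<and> (if (a \<in> X) = (z a > 0) then z b > 0 else z b < 0)"
      using pos_neg[OF that] by auto
    then obtain b where b: "a \<rightarrow>\<^bsub>G\<^esub> b" "if (a \<in> X) = (z a > 0) then z b > 0 else z b < 0"
      by blast
    then have "b \<in> W"
      using that graph_symmetric[OF b(1)] by (auto simp: W_def split: if_splits)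
    moreover have "t b mod 4 = Suc (t a) mod 4"
      using b side[OF b(1)] by (auto simp: t_def split: if_splits)
    ultimately show ?thesis using b by blast
  qed
  ultimately have "\<exists>p. cycle p \<and> 4 dvd length p"
    by (rule cycle_of_cyclic_colouring)
  with C4k_free show False by (auto simp: C4k_free_bipartite_def)
qed

lemma supports_not_adjacent:
  assumes "\<And>u. x u \<noteq> 0 \<Longrightarrow> adj_sum y u = 0" "\<And>v. y v \<noteq> 0 \<Longrightarrow> adj_sum x v = 0"
    and "u \<rightarrow>\<^bsub>G\<^esub> v"
  shows "x u = 0 \<or> y v = 0"
proof -
  obtain X Y where XY: "X \<inter> Y = {}" "\<And>u v. u \<rightarrow>\<^bsub>G\<^esub> v \<Longrightarrow> u \<in> X \<and> v \<in> Y \<or> u \<in> Y \<and> v \<in> X"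
    using C4k_free by (auto simp: C4k_free_bipartite_def bipartite_def)
  have YX: "Y \<inter> X = {}" "\<And>u v. u \<rightarrow>\<^bsub>G\<^esub> v \<Longrightarrow> u \<in> Y \<and> v \<in> X \<or> u \<in> X \<and> v \<in> Y"
    using XY by auto
  show ?thesis
    using supports_not_adjacent_bipartition[OF XY assms]
      supports_not_adjacent_bipartition[OF YX assms] XY(2)[OF assms(3)] by blast
qed

section \<open>Vanishing on the core and the null space of \<open>C_S G\<close>\<close>

lemma Supp_neighbour_in_Core: "u \<in> Supp G \<Longrightarrow> u \<rightarrow>\<^bsub>G\<^esub> v \<Longrightarrow> v \<in> Core G"
  using graph_symmetric adj_in_verts by (auto simp: Core_def)

text \<open>A core vertex is adjacent to the support of some null vector \<open>y\<close>, and that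
  support lies in \<open>Supp G\<close>, where the sums of \<open>x\<close> are zero. Asking for
  zero sums only there admits vectors \<open>x\<close> outside \<open>Null G\<close>.\<close>

lemma vanishes_on_Core:
  assumes "\<And>v. v \<in> Supp G \<Longrightarrow> adj_sum x v = 0" "c \<in> Core G"
  shows "x c = 0"
proof -
  from assms(2) obtain s y where s: "c \<rightarrow>\<^bsub>G\<^esub> s" "y \<in> Null G" "y s \<noteq> 0"
    by (auto simp: Core_def Supp_def)
  have "adj_sum x v = 0" if "y v \<noteq> 0" for v
    using that s(2) by (intro assms(1)) (auto simp: Supp_def Null_def)
  then show ?thesis
    using supports_not_adjacent[of x y c s] s Null_adj_sum by blast
qed

lemma Supp_Core_disjoint: "Supp G \<inter> Core G = {}"
  using vanishes_on_Core Null_adj_sum by (fastforce simp: Supp_def)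

lemma Supp_Core_subset: "Supp G \<union> Core G \<subseteq> verts G"
  by (auto simp: Supp_def Core_def)

text \<open>A null vector of \<open>G\<close> lives on \<open>Supp G\<close>, so it satisfies the
  equations of \<open>C_S G\<close>. Conversely, a null vector of \<open>C_S G\<close> vanishes on
  \<open>Core G\<close>, and a vertex left out of \<open>C_S G\<close> has no neighbour in
  \<open>Supp G\<close>, so its equation has only zero terms.\<close>

lemma Null_C_S: "Null (C_S G) = Null G"
proof (intro equalityI subsetI)
  fix x assume "x \<in> Null G"
  moreover from this have "x v = 0" if "v \<notin> Supp G \<union> Core G" for v
    using that by (auto simp: Supp_def Null_def)
  ultimately show "x \<in> Null (C_S G)"
    using sum_adj_matrix_induce_subgraph[OF finite_verts Supp_Core_subset, of _ x]
    by (auto simp: Null_def C_S_def Supp_def Core_def)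
next
  fix x assume x: "x \<in> Null (C_S G)"
  then have outside: "x v = 0" if "v \<notin> Supp G \<union> Core G" for v
    using that by (auto simp: Null_def C_S_def)
  have inside: "adj_sum x v = 0" if "v \<in> Supp G \<union> Core G" for v
    using sum_adj_matrix_induce_subgraph[of G _ v x, OF finite_verts Supp_Core_subset that outside]
      x that
    by (simp add: Null_def C_S_def)
  have "x v = 0" if "v \<in> Core G" for v
    by (rule vanishes_on_Core[OF _ that]) (use inside in auto)
  with outside have "adj_sum x u = 0" if "u \<notin> Supp G \<union> Core G" for u
    using that graph_symmetric Supp_neighbour_in_Core by (intro adj_sum_eq_0) (metis Un_iff)
  with inside have "adj_sum x u = 0" for u
    by blast
  moreover have "x v = 0" if "v \<notin> verts G" for v
    using that Supp_Core_subset by (intro outside) blast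
  ultimately show "x \<in> Null G"
    by (simp add: Null_def)
qed

section \<open>Unit vectors in the range of the adjacency matrix and the null space of
  \<open>C_N G\<close>\<close>

lemma ex_adj_sum_eq_unit:
  assumes "v \<in> verts G" "v \<notin> Supp G"
  shows "\<exists>b. \<forall>u \<in> verts G. adj_sum b u = (if u = v then 1 else 0)"
proof -
  let ?g = "\<lambda>u. if u = v then 1 else 0 :: real"
  have "\<exists>c. \<forall>u \<in> verts G. ?g u = (\<Sum>i \<in> verts G. c i * adj_matrix G i u)"
  proof (rule vanishing_functional_is_combination)
    fix x assume x: "\<forall>i \<in> verts G. adj_sum x i = 0"
    \<comment> \<open>Membership in \<open>Null G\<close> requires zeros off the vertex set, which
      an arbitrary \<open>x\<close> need not have.\<close>
    define x' where "x' u = (if u \<in> verts G then x u else 0)" for u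
    have "adj_sum x' i = adj_sum x i" for i
      by (rule sum.cong) (auto simp: x'_def)
    with x have "x' \<in> Null G" by (auto simp: Null_def x'_def)
    with assms have "x v = 0" by (auto simp: Supp_def x'_def)
    then show "(\<Sum>u \<in> verts G. ?g u * x u) = 0" by (intro sum.neutral) auto
  qed auto
  then obtain c where "\<forall>u \<in> verts G. ?g u = (\<Sum>i \<in> verts G. c i * adj_matrix G i u)" ..
  then have "\<forall>u \<in> verts G. adj_sum c u = ?g u"
    by (simp add: adj_matrix_commute mult.commute)
  then show ?thesis by blast
qed

text \<open>If \<open>b\<close> solves \<open>A b = e_v\<close>, symmetry of \<open>A\<close> moves
  it onto \<open>z\<close>, so \<open>z v\<close> is the inner product of \<open>A z\<close> and
  \<open>b\<close>. Every term is zero: \<open>A z\<close> vanishes on \<open>Npart G\<close> and on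
  \<open>Supp G\<close>, and \<open>b\<close> vanishes on \<open>Core G\<close>.\<close>

lemma Null_C_N:
  assumes "z \<in> Null (C_N G)"
  shows "z v = 0"
proof (cases "v \<in> Npart G")
  case False
  with assms show ?thesis by (auto simp: Null_def C_N_def)
next
  case True
  then have v: "v \<in> verts G" "v \<notin> Supp G" by (auto simp: Npart_def)
  then obtain b where b: "\<And>u. u \<in> verts G \<Longrightarrow> adj_sum b u = (if u = v then 1 else 0)"
    using ex_adj_sum_eq_unit by blast
  \<comment> \<open>As \<open>v\<close> lies outside \<open>Supp G\<close>, the unit vector at
    \<open>v\<close> is zero on \<open>Supp G\<close>, and so are the sums of
    \<open>b\<close>.\<close>
  have b_Core: "b c = 0" if "c \<in> Core G" for c
    by (rule vanishes_on_Core[OF _ that]) (use b v in \<open>auto simp: Supp_def\<close>)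
  have outside: "z u = 0" if "u \<notin> Npart G" for u
    using assms that by (auto simp: Null_def C_N_def)
  have "adj_sum z u = 0" if "u \<in> Npart G" for u
    using sum_adj_matrix_induce_subgraph[of G "Npart G" u z, OF finite_verts _ that outside]
      assms that
    by (auto simp: Null_def C_N_def Npart_def)
  moreover have "adj_sum z u = 0" if "u \<in> Supp G" for u
    using Supp_neighbour_in_Core[OF that] by (intro adj_sum_eq_0 outside) (auto simp: Npart_def)
  ultimately have z_b: "adj_sum z u * b u = 0" if "u \<in> verts G" for u
    using that b_Core by (auto simp: Npart_def)
  have "z v = (\<Sum>u \<in> verts G. z u * (if u = v then 1 else 0))"
    using v by (simp add: if_distrib[of "(*) _"] cong: if_cong)
  also have "\<dots> = (\<Sum>u \<in> verts G. z u * adj_sum b u)"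
    by (intro sum.cong) (auto simp: b)
  also have "\<dots> = (\<Sum>u \<in> verts G. \<Sum>w \<in> verts G. z u * adj_matrix G u w * b w)"
    by (simp add: sum_distrib_left mult.assoc)
  also have "\<dots> = (\<Sum>w \<in> verts G. \<Sum>u \<in> verts G. z u * adj_matrix G u w * b w)"
    by (rule sum.swap)
  also have "\<dots> = (\<Sum>w \<in> verts G. adj_sum z w * b w)"
    unfolding sum_distrib_right
    by (intro sum.cong refl) (metis adj_matrix_commute mult.commute)
  also have "\<dots> = 0"
    using z_b by (intro sum.neutral) auto
  finally show ?thesis .
qed

section \<open>Supports, cores and N-parts of the two subgraphs\<close>

lemma Supp_C_S: "Supp (C_S G) = Supp G"
proof -
  have "Supp (C_S G) = {v \<in> Supp G \<union> Core G. \<exists>x \<in> Null G. x v \<noteq> 0}"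
    unfolding Supp_def[of "C_S G"] Null_C_S by (simp add: C_S_def)
  then show ?thesis using Supp_Core_subset by (auto simp: Supp_def)
qed

lemma Core_C_S: "Core (C_S G) = Core G"
  unfolding Core_def Supp_C_S using Supp_Core_disjoint
  by (auto simp: C_S_def dominates_induce_subgraph_iff Core_def Supp_def)

lemma Npart_C_S: "Npart (C_S G) = {}"
  unfolding Npart_def Supp_C_S Core_C_S by (simp add: C_S_def)

lemma Supp_C_N: "Supp (C_N G) = {}"
  using Null_C_N by (auto simp: Supp_def)

lemma Core_C_N: "Core (C_N G) = {}"
  by (simp add: Core_def Supp_C_N)

lemma Npart_C_N: "Npart (C_N G) = Npart G"
  by (simp add: Npart_def[of "C_N G"] Supp_C_N Core_C_N) (simp add: C_N_def)

end

theorem theorem3p4: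
  fixes G :: "('a, 'b) pre_digraph"
  assumes "graph G" and "C4k_free_bipartite G"
  shows "Supp (C_S G) = Supp G \<and> Core (C_S G) = Core G \<and> Npart (C_N G) = Npart G \<and>
    Npart (C_S G) = {} \<and> Supp (C_N G) = {} \<and> Core (C_N G) = {}"
proof -
  interpret C4k_free_graph G
    using assms by (simp add: C4k_free_graph_def C4k_free_graph_axioms_def)
  show ?thesis
    using Supp_C_S Core_C_S Npart_C_N Npart_C_S Supp_C_N Core_C_N by blast
qed

end
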